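(* Let $\mathcal C_{\mathrm{bulk}}$, $\mathcal C_{p_i}$, $\Phi_i$, $\Psi_i$, $L_i$ ($1\le i\le r$) be the categories, exact functors and localized probes of a mediated triangle transport datum. Fix $j$ and let $X\in\mathcal C_{p_j}$. (1) If $X$ is right triangle-visible with respect to $L_j$, then $\mathbf{R}\mathrm{Hom}_{\mathcal C_{p_j}}(X,L_j)\not\simeq 0$. (2) If $X$ is left triangle-visible with respect to $L_j$, then $\mathbf{R}\mathrm{Hom}_{\mathcal C_{p_j}}(L_j,X)\not\simeq 0$. In particular, for every $i$, if $A_{ij}:=\Psi_j\Phi_i(L_i)\in\mathcal C_{p_j}$ is right triangle-visible with respect to $L_j$, then $$\mathsf H_{ij}=\mathbf{R}\mathrm{Hom}_{\mathcal C_{p_j}}(A_{ij},L_j)\not\simeq 0.$$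
   Context: Fix a field $k$. $D(\mathrm{Vect})$ is the derived category of complexes of $k$-vector spaces. All triangulated categories are $k$-linear, in a setting where derived Hom objects $\mathbf{R}\mathrm{Hom}_{\mathcal C}(X,Y)\in D(\mathrm{Vect})$ are defined for each localized category $\mathcal C$ below, with $H^m(\mathbf{R}\mathrm{Hom}_{\mathcal C}(X,Y))\cong\mathrm{Hom}_{\mathcal C}(X,Y[m])$; in particular $H^0(\mathbf{R}\mathrm{Hom}_{\mathcal C}(X,Y))=\mathrm{Hom}_{\mathcal C}(X,Y)$. A mediated triangle transport datum for a finite node set $\{p_1,\dots,p_r\}$ includes: a bulk triangulated category $\mathcal C_{\mathrm{bulk}}$; localized triangulated categories $\mathcal C_{p_i}$; exact functors $\Phi_i:\mathcal C_{p_i}\to\mathcal C_{\mathrm{bulk}}$ and $\Psi_i:\mathcal C_{\mathrm{bulk}}\to\mathcal C_{p_i}$; and distinguished objects ("localized probes") $L_i\in\mathcal C_{p_i}$ (together with a compatibility with a "shadow" package that plays no role here). Definition. An object $X\in\mathcal C_{p_j}$ is right triangle-visible with respect to $L_j$ if there is a distinguished triangle $B\to X\xrightarrow{u}L_j\to B[1]$ in $\mathcal C_{p_j}$ with $u\neq 0$. It is left triangle-visible with respect to $L_j$ if there is a distinguished triangle $L_j\xrightarrow{v}X\to C\to L_j[1]$ in $\mathcal C_{p_j}$ with $v\neq 0$. *)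

theory Defs
  imports "HOL-Algebra.Module" "HOL-Algebra.AbelCoset"
begin

section \<open>Complexes of vector spaces and the derived category\<close>

text \<open>A vector space over the field K is a record V with \<open>module K V\<close>; the ring multiplication
  and unit that the record type of modules carries along are junk and never used.\<close>

definition linear_map ::
  "'k ring \<Rightarrow> ('k, 'v) module \<Rightarrow> ('k, 'w) module \<Rightarrow> ('v \<Rightarrow> 'w) \<Rightarrow> bool" where
  "linear_map K V W f \<longleftrightarrow>
     f \<in> carrier V \<rightarrow> carrier W \<and>
     (\<forall>x\<in>carrier V. \<forall>y\<in>carrier V. f (x \<oplus>\<^bsub>V\<^esub> y) = f x \<oplus>\<^bsub>W\<^esub> f y) \<and>
     (\<forall>a\<in>carrier K. \<forall>x\<in>carrier V. f (a \<odot>\<^bsub>V\<^esub> x) = a \<odot>\<^bsub>W\<^esub> f x)"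

definition linear_iso ::
  "'k ring \<Rightarrow> ('k, 'v) module \<Rightarrow> ('k, 'w) module \<Rightarrow> ('v \<Rightarrow> 'w) \<Rightarrow> bool" where
  "linear_iso K V W f \<longleftrightarrow> linear_map K V W f \<and> bij_betw f (carrier V) (carrier W)"

definition quotient_module :: "('k, 'v) module \<Rightarrow> 'v set \<Rightarrow> ('k, 'v set) module" where
  "quotient_module V N =
     \<lparr>carrier = a_rcosets\<^bsub>V\<^esub> N, mult = (\<lambda>_ _. undefined), one = undefined,
      zero = N, add = set_add V,
      smult = (\<lambda>a S. \<Union>x\<in>S. N +>\<^bsub>V\<^esub> (a \<odot>\<^bsub>V\<^esub> x))\<rparr>"

record ('k, 'v) vcomplex =
  cterm :: "int \<Rightarrow> ('k, 'v) module"
  cdiff :: "int \<Rightarrow> 'v \<Rightarrow> 'v"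

locale cochain_complex = field K for K :: "'k ring" (structure) +
  fixes A :: "('k, 'v) vcomplex"
  assumes term_module: "module K (cterm A n)"
    and diff_linear: "linear_map K (cterm A n) (cterm A (n + 1)) (cdiff A n)"
    and diff_diff:
      "x \<in> carrier (cterm A n) \<Longrightarrow> cdiff A (n + 1) (cdiff A n x) = \<zero>\<^bsub>cterm A (n + 1 + 1)\<^esub>"

definition zero_complex :: "('k, 'v) vcomplex" where
  "zero_complex =
     \<lparr>cterm = (\<lambda>_. \<lparr>carrier = {undefined}, mult = (\<lambda>_ _. undefined), one = undefined,
                    zero = undefined, add = (\<lambda>_ _. undefined), smult = (\<lambda>_ _. undefined)\<rparr>),
      cdiff = (\<lambda>_ _. undefined)\<rparr>"

definition cocycles :: "('k, 'v) vcomplex \<Rightarrow> int \<Rightarrow> 'v set" where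
  "cocycles A n = a_kernel (cterm A n) (cterm A (n + 1)) (cdiff A n)"

definition coboundaries :: "('k, 'v) vcomplex \<Rightarrow> int \<Rightarrow> 'v set" where
  "coboundaries A n = cdiff A (n - 1) ` carrier (cterm A (n - 1))"

definition cohomology :: "('k, 'v) vcomplex \<Rightarrow> int \<Rightarrow> ('k, 'v set) module" where
  "cohomology A n =
     quotient_module ((cterm A n)\<lparr>carrier := cocycles A n\<rparr>) (coboundaries A n)"

definition chain_map ::
  "'k ring \<Rightarrow> ('k, 'v) vcomplex \<Rightarrow> ('k, 'v) vcomplex \<Rightarrow> (int \<Rightarrow> 'v \<Rightarrow> 'v) \<Rightarrow> bool" where
  "chain_map K A B f \<longleftrightarrow>
     cochain_complex K A \<and> cochain_complex K B \<and>
     (\<forall>n. linear_map K (cterm A n) (cterm B n) (f n)) \<and>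
     (\<forall>n. \<forall>x\<in>carrier (cterm A n). f (n + 1) (cdiff A n x) = cdiff B n (f n x))"

definition cohomology_map ::
  "('k, 'v) vcomplex \<Rightarrow> (int \<Rightarrow> 'v \<Rightarrow> 'v) \<Rightarrow> int \<Rightarrow> 'v set \<Rightarrow> 'v set" where
  "cohomology_map B f n S = (\<Union>x\<in>S. coboundaries B n +>\<^bsub>cterm B n\<^esub> f n x)"

definition quasi_iso ::
  "'k ring \<Rightarrow> ('k, 'v) vcomplex \<Rightarrow> ('k, 'v) vcomplex \<Rightarrow> (int \<Rightarrow> 'v \<Rightarrow> 'v) \<Rightarrow> bool" where
  "quasi_iso K A B f \<longleftrightarrow> chain_map K A B f \<and>
     (\<forall>n. linear_iso K (cohomology A n) (cohomology B n) (cohomology_map B f n))"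

text \<open>The derived category D(Vect) is the localization of the category of (unbounded) cochain
  complexes at the quasi-isomorphisms, presented by generators and relations: a morphism from
  A to B is a class of zigzags from A to B modulo \<open>zigzag_eq\<close>. The step \<open>Fwd A B f\<close> is the image
  of the chain map f from A to B; the step \<open>Bwd A B s\<close>, going from A to B, is the formal inverse
  of a quasi-isomorphism s from B to A. Zigzags are composed from left to right.\<close>

datatype ('k, 'v) zstep =
    Fwd "('k, 'v) vcomplex" "('k, 'v) vcomplex" "int \<Rightarrow> 'v \<Rightarrow> 'v"
  | Bwd "('k, 'v) vcomplex" "('k, 'v) vcomplex" "int \<Rightarrow> 'v \<Rightarrow> 'v"

inductive zigzag ::
  "'k ring \<Rightarrow> ('k, 'v) vcomplex \<Rightarrow> ('k, 'v) zstep list \<Rightarrow> ('k, 'v) vcomplex \<Rightarrow> bool"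
  for K where
  zigzag_Nil: "cochain_complex K A \<Longrightarrow> zigzag K A [] A"
| zigzag_Fwd: "chain_map K A B f \<Longrightarrow> zigzag K B p C \<Longrightarrow> zigzag K A (Fwd A B f # p) C"
| zigzag_Bwd: "quasi_iso K B A s \<Longrightarrow> zigzag K B p C \<Longrightarrow> zigzag K A (Bwd A B s # p) C"

text \<open>Chain maps are only relevant on the carriers, so the relations for identities and
  composites are stated up to agreement there.\<close>

inductive zigzag_eq ::
  "'k ring \<Rightarrow> ('k, 'v) vcomplex \<Rightarrow> ('k, 'v) vcomplex \<Rightarrow>
    ('k, 'v) zstep list \<Rightarrow> ('k, 'v) zstep list \<Rightarrow> bool"
  for K where
  zz_refl: "zigzag K A p B \<Longrightarrow> zigzag_eq K A B p p"
| zz_sym: "zigzag_eq K A B p q \<Longrightarrow> zigzag_eq K A B q p"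
| zz_trans: "zigzag_eq K A B p q \<Longrightarrow> zigzag_eq K A B q s \<Longrightarrow> zigzag_eq K A B p s"
| zz_append: "zigzag_eq K A B p p' \<Longrightarrow> zigzag_eq K B C q q' \<Longrightarrow>
    zigzag_eq K A C (p @ q) (p' @ q')"
| zz_id: "chain_map K A A f \<Longrightarrow> (\<And>n x. x \<in> carrier (cterm A n) \<Longrightarrow> f n x = x) \<Longrightarrow>
    zigzag_eq K A A [Fwd A A f] []"
| zz_comp: "chain_map K A B f \<Longrightarrow> chain_map K B C g \<Longrightarrow> chain_map K A C h \<Longrightarrow>
    (\<And>n x. x \<in> carrier (cterm A n) \<Longrightarrow> h n x = g n (f n x)) \<Longrightarrow>
    zigzag_eq K A C [Fwd A B f, Fwd B C g] [Fwd A C h]"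
| zz_inv_right: "quasi_iso K A B s \<Longrightarrow> zigzag_eq K A A [Fwd A B s, Bwd B A s] []"
| zz_inv_left: "quasi_iso K A B s \<Longrightarrow> zigzag_eq K B B [Bwd B A s, Fwd A B s] []"

definition derived_isomorphic ::
  "'k ring \<Rightarrow> ('k, 'v) vcomplex \<Rightarrow> ('k, 'v) vcomplex \<Rightarrow> bool" where
  "derived_isomorphic K A B \<longleftrightarrow>
     (\<exists>p q. zigzag K A p B \<and> zigzag K B q A \<and>
            zigzag_eq K A A (p @ q) [] \<and> zigzag_eq K B B (q @ p) [])"


section \<open>Linear categories and functors\<close>

record ('k, 'o, 'm) lincat =
  ob :: "'o set"
  hm :: "'o \<Rightarrow> 'o \<Rightarrow> ('k, 'm) module"
  idm :: "'o \<Rightarrow> 'm"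
  cmp :: "'m \<Rightarrow> 'm \<Rightarrow> 'm"  (infixl \<open>\<cdot>\<index>\<close> 70)

locale linear_category = field K for K :: "'k ring" (structure) +
  fixes C :: "('k, 'o, 'm, 'z) lincat_scheme"
  assumes hom_module: "X \<in> ob C \<Longrightarrow> Y \<in> ob C \<Longrightarrow> module K (hm C X Y)"
    and hom_disjoint:
      "\<lbrakk>X \<in> ob C; Y \<in> ob C; X' \<in> ob C; Y' \<in> ob C;
        f \<in> carrier (hm C X Y); f \<in> carrier (hm C X' Y')\<rbrakk> \<Longrightarrow> X = X' \<and> Y = Y'"
    and id_closed: "X \<in> ob C \<Longrightarrow> idm C X \<in> carrier (hm C X X)"
    and comp_closed:
      "\<lbrakk>X \<in> ob C; Y \<in> ob C; Z \<in> ob C; f \<in> carrier (hm C X Y); g \<in> carrier (hm C Y Z)\<rbrakk>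
        \<Longrightarrow> g \<cdot>\<^bsub>C\<^esub> f \<in> carrier (hm C X Z)"
    and id_left:
      "\<lbrakk>X \<in> ob C; Y \<in> ob C; f \<in> carrier (hm C X Y)\<rbrakk> \<Longrightarrow> idm C Y \<cdot>\<^bsub>C\<^esub> f = f"
    and id_right:
      "\<lbrakk>X \<in> ob C; Y \<in> ob C; f \<in> carrier (hm C X Y)\<rbrakk> \<Longrightarrow> f \<cdot>\<^bsub>C\<^esub> idm C X = f"
    and comp_assoc:
      "\<lbrakk>W \<in> ob C; X \<in> ob C; Y \<in> ob C; Z \<in> ob C;
        f \<in> carrier (hm C W X); g \<in> carrier (hm C X Y); h \<in> carrier (hm C Y Z)\<rbrakk>
        \<Longrightarrow> (h \<cdot>\<^bsub>C\<^esub> g) \<cdot>\<^bsub>C\<^esub> f = h \<cdot>\<^bsub>C\<^esub> (g \<cdot>\<^bsub>C\<^esub> f)"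
    and comp_linear_right:
      "\<lbrakk>X \<in> ob C; Y \<in> ob C; Z \<in> ob C; g \<in> carrier (hm C Y Z)\<rbrakk>
        \<Longrightarrow> linear_map K (hm C X Y) (hm C X Z) (\<lambda>f. g \<cdot>\<^bsub>C\<^esub> f)"
    and comp_linear_left:
      "\<lbrakk>X \<in> ob C; Y \<in> ob C; Z \<in> ob C; f \<in> carrier (hm C X Y)\<rbrakk>
        \<Longrightarrow> linear_map K (hm C Y Z) (hm C X Z) (\<lambda>g. g \<cdot>\<^bsub>C\<^esub> f)"

definition iso_mor ::
  "('k, 'o, 'm, 'z) lincat_scheme \<Rightarrow> 'o \<Rightarrow> 'o \<Rightarrow> 'm \<Rightarrow> bool" where
  "iso_mor C X Y f \<longleftrightarrow> f \<in> carrier (hm C X Y) \<and>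
     (\<exists>g\<in>carrier (hm C Y X). g \<cdot>\<^bsub>C\<^esub> f = idm C X \<and> f \<cdot>\<^bsub>C\<^esub> g = idm C Y)"

definition zero_object :: "('k, 'o, 'm, 'z) lincat_scheme \<Rightarrow> 'o \<Rightarrow> bool" where
  "zero_object C Z \<longleftrightarrow> Z \<in> ob C \<and>
     (\<forall>X\<in>ob C. (\<exists>!f. f \<in> carrier (hm C X Z)) \<and> (\<exists>!f. f \<in> carrier (hm C Z X)))"

definition is_biproduct ::
  "('k, 'o, 'm, 'z) lincat_scheme \<Rightarrow> 'o \<Rightarrow> 'o \<Rightarrow> 'o \<Rightarrow> 'm \<Rightarrow> 'm \<Rightarrow> 'm \<Rightarrow> 'm \<Rightarrow> bool" where
  "is_biproduct C X Y P i1 i2 p1 p2 \<longleftrightarrow> P \<in> ob C \<and>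
     i1 \<in> carrier (hm C X P) \<and> i2 \<in> carrier (hm C Y P) \<and>
     p1 \<in> carrier (hm C P X) \<and> p2 \<in> carrier (hm C P Y) \<and>
     p1 \<cdot>\<^bsub>C\<^esub> i1 = idm C X \<and> p2 \<cdot>\<^bsub>C\<^esub> i2 = idm C Y \<and>
     p2 \<cdot>\<^bsub>C\<^esub> i1 = \<zero>\<^bsub>hm C X Y\<^esub> \<and> p1 \<cdot>\<^bsub>C\<^esub> i2 = \<zero>\<^bsub>hm C Y X\<^esub> \<and>
     (i1 \<cdot>\<^bsub>C\<^esub> p1) \<oplus>\<^bsub>hm C P P\<^esub> (i2 \<cdot>\<^bsub>C\<^esub> p2) = idm C P"

locale additive_linear_category = linear_category K C
  for K :: "'k ring" (structure) and C :: "('k, 'o, 'm, 'z) lincat_scheme" +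
  assumes ex_zero_object: "\<exists>Z. zero_object C Z"
    and ex_biproduct: "X \<in> ob C \<Longrightarrow> Y \<in> ob C \<Longrightarrow> \<exists>P i1 i2 p1 p2. is_biproduct C X Y P i1 i2 p1 p2"

record ('o, 'm, 'p, 'n) fnc =
  fob :: "'o \<Rightarrow> 'p"
  fmor :: "'m \<Rightarrow> 'n"

definition fnc_id :: "('o, 'm, 'o, 'm) fnc" where
  "fnc_id = \<lparr>fob = id, fmor = id\<rparr>"

definition fnc_comp ::
  "('p, 'n, 'q, 'l) fnc \<Rightarrow> ('o, 'm, 'p, 'n) fnc \<Rightarrow> ('o, 'm, 'q, 'l) fnc" where
  "fnc_comp G F = \<lparr>fob = fob G \<circ> fob F, fmor = fmor G \<circ> fmor F\<rparr>"

definition additive_functor ::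
  "('k, 'o, 'm, 'y) lincat_scheme \<Rightarrow> ('k, 'p, 'n, 'z) lincat_scheme \<Rightarrow>
    ('o, 'm, 'p, 'n) fnc \<Rightarrow> bool" where
  "additive_functor C D F \<longleftrightarrow>
     (\<forall>X\<in>ob C. fob F X \<in> ob D \<and> fmor F (idm C X) = idm D (fob F X)) \<and>
     (\<forall>X\<in>ob C. \<forall>Y\<in>ob C. \<forall>f\<in>carrier (hm C X Y). fmor F f \<in> carrier (hm D (fob F X) (fob F Y))) \<and>
     (\<forall>X\<in>ob C. \<forall>Y\<in>ob C. \<forall>Z\<in>ob C. \<forall>f\<in>carrier (hm C X Y). \<forall>g\<in>carrier (hm C Y Z).
        fmor F (g \<cdot>\<^bsub>C\<^esub> f) = fmor F g \<cdot>\<^bsub>D\<^esub> fmor F f) \<and>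
     (\<forall>X\<in>ob C. \<forall>Y\<in>ob C. \<forall>f\<in>carrier (hm C X Y). \<forall>g\<in>carrier (hm C X Y).
        fmor F (f \<oplus>\<^bsub>hm C X Y\<^esub> g) = fmor F f \<oplus>\<^bsub>hm D (fob F X) (fob F Y)\<^esub> fmor F g)"

definition linear_functor ::
  "'k ring \<Rightarrow> ('k, 'o, 'm, 'y) lincat_scheme \<Rightarrow> ('k, 'p, 'n, 'z) lincat_scheme \<Rightarrow>
    ('o, 'm, 'p, 'n) fnc \<Rightarrow> bool" where
  "linear_functor K C D F \<longleftrightarrow> additive_functor C D F \<and>
     (\<forall>X\<in>ob C. \<forall>Y\<in>ob C. linear_map K (hm C X Y) (hm D (fob F X) (fob F Y)) (fmor F))"

definition natural_iso ::
  "('k, 'o, 'm, 'y) lincat_scheme \<Rightarrow> ('k, 'p, 'n, 'z) lincat_scheme \<Rightarrow>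
    ('o, 'm, 'p, 'n) fnc \<Rightarrow> ('o, 'm, 'p, 'n) fnc \<Rightarrow> ('o \<Rightarrow> 'n) \<Rightarrow> bool" where
  "natural_iso C D F G \<eta> \<longleftrightarrow>
     (\<forall>X\<in>ob C. iso_mor D (fob F X) (fob G X) (\<eta> X)) \<and>
     (\<forall>X\<in>ob C. \<forall>Y\<in>ob C. \<forall>f\<in>carrier (hm C X Y). \<eta> Y \<cdot>\<^bsub>D\<^esub> fmor F f = fmor G f \<cdot>\<^bsub>D\<^esub> \<eta> X)"


section \<open>Triangulated categories and exact functors\<close>

text \<open>The translation functor is an auto-equivalence, given together with a chosen
  quasi-inverse \<open>unshift\<close>. \<open>dist T X Y Z f g h\<close> says that
  X --f--> Y --g--> Z --h--> X[1] is a distinguished triangle.\<close>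

record ('k, 'o, 'm) tricat = "('k, 'o, 'm) lincat" +
  shift :: "('o, 'm, 'o, 'm) fnc"
  unshift :: "('o, 'm, 'o, 'm) fnc"
  dist :: "'o \<Rightarrow> 'o \<Rightarrow> 'o \<Rightarrow> 'm \<Rightarrow> 'm \<Rightarrow> 'm \<Rightarrow> bool"

locale triangulated_category = additive_linear_category K T
  for K :: "'k ring" (structure) and T :: "('k, 'o, 'm) tricat" +
  assumes shift_linear: "linear_functor K T T (shift T)"
    and unshift_linear: "linear_functor K T T (unshift T)"
    and unshift_shift: "\<exists>\<eta>. natural_iso T T fnc_id (fnc_comp (unshift T) (shift T)) \<eta>"
    and shift_unshift: "\<exists>\<epsilon>. natural_iso T T (fnc_comp (shift T) (unshift T)) fnc_id \<epsilon>"
    and dist_wf: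
      "dist T X Y Z f g h \<Longrightarrow> X \<in> ob T \<and> Y \<in> ob T \<and> Z \<in> ob T \<and>
         f \<in> carrier (hm T X Y) \<and> g \<in> carrier (hm T Y Z) \<and> h \<in> carrier (hm T Z (fob (shift T) X))"
    and TR1_id:
      "\<lbrakk>X \<in> ob T; zero_object T Z\<rbrakk> \<Longrightarrow>
         dist T X X Z (idm T X) \<zero>\<^bsub>hm T X Z\<^esub> \<zero>\<^bsub>hm T Z (fob (shift T) X)\<^esub>"
    and TR1_iso:
      "\<lbrakk>dist T X Y Z f g h; X' \<in> ob T; Y' \<in> ob T; Z' \<in> ob T;
        f' \<in> carrier (hm T X' Y'); g' \<in> carrier (hm T Y' Z');
        h' \<in> carrier (hm T Z' (fob (shift T) X'));
        iso_mor T X X' a; iso_mor T Y Y' b; iso_mor T Z Z' c;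
        b \<cdot>\<^bsub>T\<^esub> f = f' \<cdot>\<^bsub>T\<^esub> a; c \<cdot>\<^bsub>T\<^esub> g = g' \<cdot>\<^bsub>T\<^esub> b; fmor (shift T) a \<cdot>\<^bsub>T\<^esub> h = h' \<cdot>\<^bsub>T\<^esub> c\<rbrakk>
        \<Longrightarrow> dist T X' Y' Z' f' g' h'"
    and TR1_cone:
      "\<lbrakk>X \<in> ob T; Y \<in> ob T; f \<in> carrier (hm T X Y)\<rbrakk> \<Longrightarrow> \<exists>Z g h. dist T X Y Z f g h"
    and TR2:
      "\<lbrakk>X \<in> ob T; Y \<in> ob T; Z \<in> ob T; f \<in> carrier (hm T X Y); g \<in> carrier (hm T Y Z);
        h \<in> carrier (hm T Z (fob (shift T) X))\<rbrakk> \<Longrightarrow>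
         dist T X Y Z f g h \<longleftrightarrow>
         dist T Y Z (fob (shift T) X) g h
           (\<ominus>\<^bsub>hm T (fob (shift T) X) (fob (shift T) Y)\<^esub> fmor (shift T) f)"
    and TR3:
      "\<lbrakk>dist T X Y Z f g h; dist T X' Y' Z' f' g' h';
        a \<in> carrier (hm T X X'); b \<in> carrier (hm T Y Y'); b \<cdot>\<^bsub>T\<^esub> f = f' \<cdot>\<^bsub>T\<^esub> a\<rbrakk>
        \<Longrightarrow> \<exists>c\<in>carrier (hm T Z Z').
              c \<cdot>\<^bsub>T\<^esub> g = g' \<cdot>\<^bsub>T\<^esub> b \<and> fmor (shift T) a \<cdot>\<^bsub>T\<^esub> h = h' \<cdot>\<^bsub>T\<^esub> c"
    and TR4:
      "\<lbrakk>dist T X Y Z' f a b; dist T Y Z X' g c e; dist T X Z Y' (g \<cdot>\<^bsub>T\<^esub> f) p q\<rbrakk>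
        \<Longrightarrow> \<exists>u v. dist T Z' Y' X' u v (fmor (shift T) a \<cdot>\<^bsub>T\<^esub> e) \<and>
              u \<cdot>\<^bsub>T\<^esub> a = p \<cdot>\<^bsub>T\<^esub> g \<and> q \<cdot>\<^bsub>T\<^esub> u = b \<and>
              v \<cdot>\<^bsub>T\<^esub> p = c \<and> e \<cdot>\<^bsub>T\<^esub> v = fmor (shift T) f \<cdot>\<^bsub>T\<^esub> q"

definition exact_functor ::
  "('k, 'o, 'm) tricat \<Rightarrow> ('k, 'p, 'n) tricat \<Rightarrow> ('o, 'm, 'p, 'n) fnc \<Rightarrow> bool" where
  "exact_functor S T F \<longleftrightarrow> additive_functor S T F \<and>
     (\<exists>\<eta>. natural_iso S T (fnc_comp F (shift S)) (fnc_comp (shift T) F) \<eta> \<and>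
          (\<forall>X Y Z f g h. dist S X Y Z f g h \<longrightarrow>
             dist T (fob F X) (fob F Y) (fob F Z) (fmor F f) (fmor F g) (\<eta> X \<cdot>\<^bsub>T\<^esub> fmor F h)))"

definition shift_by :: "('k, 'o, 'm) tricat \<Rightarrow> int \<Rightarrow> 'o \<Rightarrow> 'o" where
  "shift_by T m Y =
     (if m \<ge> 0 then (fob (shift T) ^^ nat m) Y else (fob (unshift T) ^^ nat (- m)) Y)"

definition derived_hom ::
  "'k ring \<Rightarrow> ('k, 'o, 'm) tricat \<Rightarrow> ('o \<Rightarrow> 'o \<Rightarrow> ('k, 'v) vcomplex) \<Rightarrow> bool" where
  "derived_hom K T RHom \<longleftrightarrow>
     (\<forall>X\<in>ob T. \<forall>Y\<in>ob T. cochain_complex K (RHom X Y) \<and>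
        (\<forall>m. \<exists>\<phi>. linear_iso K (cohomology (RHom X Y) m) (hm T X (shift_by T m Y)) \<phi>))"


section \<open>Triangle visibility and transport data\<close>

definition right_triangle_visible :: "('k, 'o, 'm) tricat \<Rightarrow> 'o \<Rightarrow> 'o \<Rightarrow> bool" where
  "right_triangle_visible T L X \<longleftrightarrow> (\<exists>B w u h. dist T B X L w u h \<and> u \<noteq> \<zero>\<^bsub>hm T X L\<^esub>)"

definition left_triangle_visible :: "('k, 'o, 'm) tricat \<Rightarrow> 'o \<Rightarrow> 'o \<Rightarrow> bool" where
  "left_triangle_visible T L X \<longleftrightarrow> (\<exists>C v g h. dist T L X C v g h \<and> v \<noteq> \<zero>\<^bsub>hm T L X\<^esub>)"

text \<open>The nodes are indexed by 1, ..., r. The compatibility of a transport datum with a shadow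
  package is not part of this locale.\<close>

locale mediated_triangle_transport_datum =
  fixes K :: "'k ring" and r :: nat
    and Cbulk :: "('k, 'p, 'n) tricat"
    and C :: "nat \<Rightarrow> ('k, 'o, 'm) tricat"
    and \<Phi> :: "nat \<Rightarrow> ('o, 'm, 'p, 'n) fnc"
    and \<Psi> :: "nat \<Rightarrow> ('p, 'n, 'o, 'm) fnc"
    and L :: "nat \<Rightarrow> 'o"
  assumes bulk_triangulated: "triangulated_category K Cbulk"
    and local_triangulated: "i \<in> {1..r} \<Longrightarrow> triangulated_category K (C i)"
    and \<Phi>_exact: "i \<in> {1..r} \<Longrightarrow> exact_functor (C i) Cbulk (\<Phi> i)"
    and \<Psi>_exact: "i \<in> {1..r} \<Longrightarrow> exact_functor Cbulk (C i) (\<Psi> i)"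
    and probe_ob: "i \<in> {1..r} \<Longrightarrow> L i \<in> ob (C i)"

definition transported_probe ::
  "(nat \<Rightarrow> ('o, 'm, 'p, 'n) fnc) \<Rightarrow> (nat \<Rightarrow> ('p, 'n, 'o, 'm) fnc) \<Rightarrow> (nat \<Rightarrow> 'o) \<Rightarrow>
    nat \<Rightarrow> nat \<Rightarrow> 'o" where
  "transported_probe \<Phi> \<Psi> L i j = fob (\<Psi> j) (fob (\<Phi> i) (L i))"

definition transport_hom ::
  "(nat \<Rightarrow> ('o, 'm, 'p, 'n) fnc) \<Rightarrow> (nat \<Rightarrow> ('p, 'n, 'o, 'm) fnc) \<Rightarrow> (nat \<Rightarrow> 'o) \<Rightarrow>
    (nat \<Rightarrow> 'o \<Rightarrow> 'o \<Rightarrow> ('k, 'v) vcomplex) \<Rightarrow> nat \<Rightarrow> nat \<Rightarrow> ('k, 'v) vcomplex" where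
  "transport_hom \<Phi> \<Psi> L RHom i j = RHom j (transported_probe \<Phi> \<Psi> L i j) (L j)"

end

theory Submission
  imports Defs
begin

text \<open>In each degree, cohomology is a functor on complexes that turns quasi-isomorphisms into
  bijections, so it acts on zigzags modulo \<open>zigzag_eq\<close> and every complex isomorphic to zero in the
  derived category is acyclic. A nonzero morphism of a visibility triangle is a nonzero class in
  degree zero of the derived Hom complex, which is therefore not acyclic.\<close>

section \<open>Linear maps and cohomology classes\<close>

lemma linear_mapD:
  assumes "linear_map K V W f"
  shows linear_map_closed: "x \<in> carrier V \<Longrightarrow> f x \<in> carrier W"
    and linear_map_add:
      "x \<in> carrier V \<Longrightarrow> y \<in> carrier V \<Longrightarrow> f (x \<oplus>\<^bsub>V\<^esub> y) = f x \<oplus>\<^bsub>W\<^esub> f y"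
  using assms unfolding linear_map_def by auto

text \<open>Connects \<open>linear_map\<close> with group homomorphisms, for preservation of zero
  and for images being subgroups.\<close>

lemma linear_map_abelian_group_hom:
  assumes "module K V" "module K W" "linear_map K V W f"
  shows "abelian_group_hom V W f"
proof -
  interpret V: module K V by fact
  interpret W: module K W by fact
  show ?thesis
    using linear_mapD[OF assms(3)]
    by (intro abelian_group_homI V.abelian_group_axioms W.abelian_group_axioms group_hom.intro
        group_hom_axioms.intro homI V.a_group W.a_group) auto
qed

text \<open>Restricting the carrier to the cocycles leaves the addition alone, so cosets may be
  formed in the full module \<open>cterm A n\<close>.\<close>

lemma cohomology_carrier:
  "carrier (cohomology A n) = (\<lambda>x. coboundaries A n +>\<^bsub>cterm A n\<^esub> x) ` cocycles A n"
  by (auto simp: cohomology_def quotient_module_def A_RCOSETS_def a_r_coset_def RCOSETS_def r_coset_def)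

lemma cocycles_iff:
  "x \<in> cocycles A n \<longleftrightarrow>
     x \<in> carrier (cterm A n) \<and> cdiff A n x = \<zero>\<^bsub>cterm A (n + 1)\<^esub>"
  by (simp add: cocycles_def a_kernel_def kernel_def)

context cochain_complex
begin

lemma diff_hom: "abelian_group_hom (cterm A n) (cterm A (n + 1)) (cdiff A n)"
  by (rule linear_map_abelian_group_hom[OF term_module term_module diff_linear])

lemma coboundaries_subgroup: "subgroup (coboundaries A n) (add_monoid (cterm A n))"
proof -
  \<comment> \<open>The differential into degree \<open>n\<close> starts in degree
    \<open>n - 1\<close>; its target \<open>n - 1 + 1\<close> simplifies to
    \<open>n\<close>.\<close>
  interpret d: abelian_group_hom "cterm A (n - 1)" "cterm A n" "cdiff A (n - 1)"
    using diff_hom[of "n - 1"] by simp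
  show ?thesis
    using group_hom.img_is_subgroup[OF d.a_group_hom] by (simp add: coboundaries_def)
qed

lemma coboundaries_subset: "coboundaries A n \<subseteq> carrier (cterm A n)"
  using subgroup.subset[OF coboundaries_subgroup] by simp

end

section \<open>Functoriality of cohomology\<close>

lemma chain_map_cocycles:
  assumes "chain_map K A B f" "x \<in> cocycles A n"
  shows "f n x \<in> cocycles B n"
proof -
  interpret A: cochain_complex K A using assms(1) by (simp add: chain_map_def)
  interpret B: cochain_complex K B using assms(1) by (simp add: chain_map_def)
  have lin: "linear_map K (cterm A m) (cterm B m) (f m)" for m
    using assms(1) by (simp add: chain_map_def)
  \<comment> \<open>Needed for \<open>f (n + 1)\<close> to map zero to zero.\<close>
  interpret f: abelian_group_hom "cterm A (n + 1)" "cterm B (n + 1)" "f (n + 1)"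
    by (rule linear_map_abelian_group_hom[OF A.term_module B.term_module lin])
  have "cdiff B n (f n x) = f (n + 1) (cdiff A n x)"
    using assms unfolding chain_map_def cocycles_iff by metis
  then show ?thesis
    using assms(2) linear_map_closed[OF lin] by (simp add: cocycles_iff)
qed

lemma chain_map_coboundaries:
  assumes "chain_map K A B f" "x \<in> coboundaries A n"
  shows "f n x \<in> coboundaries B n"
proof -
  obtain y where y: "y \<in> carrier (cterm A (n - 1))" "x = cdiff A (n - 1) y"
    using assms(2) by (auto simp: coboundaries_def)
  have comm: "\<forall>m. \<forall>y\<in>carrier (cterm A m). f (m + 1) (cdiff A m y) = cdiff B m (f m y)"
    and lin: "linear_map K (cterm A (n - 1)) (cterm B (n - 1)) (f (n - 1))"
    using assms(1) by (simp_all add: chain_map_def)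
  have "f n x = cdiff B (n - 1) (f (n - 1) y)"
    using comm[rule_format, of y "n - 1"] y by simp
  then show ?thesis
    using linear_map_closed[OF lin y(1)] by (simp add: coboundaries_def)
qed

text \<open>Well-definedness on classes: another representative differs by a coboundary, whose image
  is a coboundary and is absorbed by the target coset. The union in \<open>cohomology_map\<close>
  thus runs over equal sets.\<close>

lemma cohomology_map_coset:
  assumes f: "chain_map K A B f" and x: "x \<in> cocycles A n"
  shows "cohomology_map B f n (coboundaries A n +>\<^bsub>cterm A n\<^esub> x) =
    coboundaries B n +>\<^bsub>cterm B n\<^esub> f n x"
proof -
  interpret A: cochain_complex K A using f by (simp add: chain_map_def)
  interpret B: cochain_complex K B using f by (simp add: chain_map_def)
  interpret Bn: module K "cterm B n" by (rule B.term_module)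
  have lin: "linear_map K (cterm A n) (cterm B n) (f n)"
    using f by (simp add: chain_map_def)
  have x': "x \<in> carrier (cterm A n)" using x by (simp add: cocycles_iff)
  have same: "coboundaries B n +>\<^bsub>cterm B n\<^esub> f n (b \<oplus>\<^bsub>cterm A n\<^esub> x) =
      coboundaries B n +>\<^bsub>cterm B n\<^esub> f n x" if b: "b \<in> coboundaries A n" for b
  proof -
    have b': "b \<in> carrier (cterm A n)" using b A.coboundaries_subset by blast
    have fb: "f n b \<in> coboundaries B n" by (rule chain_map_coboundaries[OF f b])
    have "coboundaries B n +>\<^bsub>cterm B n\<^esub> f n (b \<oplus>\<^bsub>cterm A n\<^esub> x) =
        (coboundaries B n +>\<^bsub>cterm B n\<^esub> f n b) +>\<^bsub>cterm B n\<^esub> f n x"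
      using linear_mapD[OF lin] b' x' B.coboundaries_subset
      by (simp add: Bn.a_coset_add_assoc)
    also have "coboundaries B n +>\<^bsub>cterm B n\<^esub> f n b = coboundaries B n"
      using B.coboundaries_subgroup fb B.coboundaries_subset
      by (intro Bn.a_coset_join2) auto
    finally show ?thesis .
  qed
  \<comment> \<open>A union of equal sets is that set only if the family is nonempty.\<close>
  have "coboundaries A n \<noteq> {}"
    using subgroup.one_closed[OF A.coboundaries_subgroup] by blast
  then show ?thesis
    using same by (auto simp: cohomology_map_def a_r_coset_def[of "cterm A n"] r_coset_def)
qed

lemma cohomology_map_closed:
  assumes "chain_map K A B f" "c \<in> carrier (cohomology A n)"
  shows "cohomology_map B f n c \<in> carrier (cohomology B n)"
  using assms cohomology_map_coset[OF assms(1)] chain_map_cocycles[OF assms(1)]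
  by (auto simp: cohomology_carrier)

text \<open>Agreement on carriers suffices because classes are represented by cocycles there; this
  is the form that \<open>zz_id\<close> provides.\<close>

lemma cohomology_map_id:
  assumes "chain_map K A A f" "\<And>n x. x \<in> carrier (cterm A n) \<Longrightarrow> f n x = x"
    and "c \<in> carrier (cohomology A n)"
  shows "cohomology_map A f n c = c"
  using assms cohomology_map_coset[OF assms(1)]
  by (auto simp: cohomology_carrier cocycles_iff)

lemma cohomology_map_comp:
  assumes "chain_map K A B f" "chain_map K B C g" "chain_map K A C h"
    and "\<And>n x. x \<in> carrier (cterm A n) \<Longrightarrow> h n x = g n (f n x)"
    and "c \<in> carrier (cohomology A n)"
  shows "cohomology_map C h n c = cohomology_map C g n (cohomology_map B f n c)"
proof -
  obtain x where x: "x \<in> cocycles A n" "c = coboundaries A n +>\<^bsub>cterm A n\<^esub> x"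
    using assms(5) by (auto simp: cohomology_carrier)
  then show ?thesis
    using assms(4)[of x n] chain_map_cocycles[OF assms(1) x(1)]
    by (simp add: cohomology_map_coset[OF assms(1)] cohomology_map_coset[OF assms(2)]
        cohomology_map_coset[OF assms(3)] cocycles_iff[of x A])
qed

section \<open>Action of zigzags on cohomology\<close>

lemma quasi_iso_chain_map: "quasi_iso K A B s \<Longrightarrow> chain_map K A B s"
  by (simp add: quasi_iso_def)

lemma quasi_iso_bij_betw:
  "quasi_iso K A B s \<Longrightarrow>
     bij_betw (cohomology_map B s n) (carrier (cohomology A n)) (carrier (cohomology B n))"
  by (simp add: quasi_iso_def linear_iso_def)

text \<open>In \<open>Bwd A B s\<close> the map \<open>s\<close> runs from \<open>B\<close> to
  \<open>A\<close>, so the step acts by the inverse of its bijection on cohomology, restricted to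
  the classes of \<open>B\<close>.\<close>

fun zstep_cohomology :: "int \<Rightarrow> ('k, 'v) zstep \<Rightarrow> 'v set \<Rightarrow> 'v set" where
  "zstep_cohomology n (Fwd A B f) = cohomology_map B f n"
| "zstep_cohomology n (Bwd A B s) = inv_into (carrier (cohomology B n)) (cohomology_map A s n)"

text \<open>\<open>fold\<close> applies the head of the list first, matching left-to-right
  composition of zigzags.\<close>

definition zigzag_cohomology :: "int \<Rightarrow> ('k, 'v) zstep list \<Rightarrow> 'v set \<Rightarrow> 'v set" where
  "zigzag_cohomology n p = fold (zstep_cohomology n) p"

lemma zigzag_cohomology_simps [simp]:
  "zigzag_cohomology n [] c = c"
  "zigzag_cohomology n (s # p) c = zigzag_cohomology n p (zstep_cohomology n s c)"
  "zigzag_cohomology n (p @ q) c = zigzag_cohomology n q (zigzag_cohomology n p c)"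
  by (simp_all add: zigzag_cohomology_def)

lemma zigzag_cohomology_closed:
  assumes "zigzag K A p B" "c \<in> carrier (cohomology A n)"
  shows "zigzag_cohomology n p c \<in> carrier (cohomology B n)"
  using assms
proof (induction arbitrary: c)
  case (zigzag_Bwd B A s p C)
  then show ?case
    \<comment> \<open>Surjectivity makes \<open>inv_into\<close> return a class in the
      carrier.\<close>
    using quasi_iso_bij_betw[OF zigzag_Bwd.hyps(1), of n]
    by (auto simp: bij_betw_def intro!: zigzag_Bwd.IH inv_into_into)
qed (auto intro: cohomology_map_closed)

lemma zigzag_append:
  assumes "zigzag K A p B" "zigzag K B q C"
  shows "zigzag K A (p @ q) C"
  using assms by induction (auto intro: zigzag.intros)

text \<open>The zigzag part of the conclusion is what carries the induction through \<open>zz_append\<close>.\<close>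

lemma zigzag_eq_cohomology:
  assumes "zigzag_eq K A B p q"
  shows "zigzag K A p B \<and> zigzag K A q B \<and>
    (\<forall>c\<in>carrier (cohomology A n). zigzag_cohomology n p c = zigzag_cohomology n q c)"
  using assms
proof induction
  case (zz_append A B p p' C q q')
  \<comment> \<open>\<open>q\<close> and \<open>q'\<close> are compared at the image of
    \<open>c\<close>, which closure places in the cohomology of \<open>B\<close>.\<close>
  then show ?case by (auto intro: zigzag_append zigzag_cohomology_closed)
next
  case (zz_id A f)
  then show ?case
    by (auto simp: chain_map_def cohomology_map_id intro!: zigzag.intros)
next
  case (zz_comp A B f C g h)
  then have "cohomology_map C g n (cohomology_map B f n c) = cohomology_map C h n c"
    if "c \<in> carrier (cohomology A n)" for c
    using cohomology_map_comp[OF zz_comp that] by simp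
  then show ?case
    using zz_comp by (auto simp: chain_map_def intro!: zigzag.intros)
next
  case (zz_inv_right A B s)
  then show ?case
    \<comment> \<open>Going forward and then back is the identity by injectivity.\<close>
    using quasi_iso_bij_betw[OF zz_inv_right, of n] quasi_iso_chain_map[OF zz_inv_right]
    by (auto simp: bij_betw_def chain_map_def intro!: zigzag.intros)
next
  case (zz_inv_left A B s)
  then show ?case
    \<comment> \<open>Going back and then forward is the identity by surjectivity.\<close>
    using quasi_iso_bij_betw[OF zz_inv_left, of n] quasi_iso_chain_map[OF zz_inv_left]
    by (auto simp: bij_betw_def chain_map_def f_inv_into_f intro!: zigzag.intros)
qed auto

text \<open>The only cocycle is \<open>undefined\<close>, so there is at most one coset. Naming the
  complex \<open>Z\<close> forces one scalar type in both assumptions, since a carrier does not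
  record it.\<close>

lemma zero_complex_cohomology:
  fixes Z :: "('k, 'v) vcomplex"
  assumes Z: "Z = zero_complex" and "c \<in> carrier (cohomology Z n)" "d \<in> carrier (cohomology Z n)"
  shows "c = d"
proof -
  have "x = undefined" if "x \<in> cocycles Z n" for x
    using that by (simp add: Z cocycles_iff zero_complex_def)
  with assms(2,3) show ?thesis by (auto simp: cohomology_carrier)
qed

text \<open>The identity on cohomology factors through that of the zero complex, via
  \<open>p\<close> and then \<open>q\<close>, so any two classes coincide.\<close>

lemma derived_isomorphic_zero_cohomology:
  assumes "derived_isomorphic K A zero_complex"
    and "c \<in> carrier (cohomology A n)" "d \<in> carrier (cohomology A n)"
  shows "c = d"
proof -
  obtain p q where p: "zigzag K A p zero_complex" and pq: "zigzag_eq K A A (p @ q) []"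
    using assms(1) by (auto simp: derived_isomorphic_def)
  have "zigzag_cohomology n p c = zigzag_cohomology n p d"
    using zero_complex_cohomology[OF refl] zigzag_cohomology_closed[OF p] assms(2,3) by blast
  moreover have "zigzag_cohomology n q (zigzag_cohomology n p e) = e"
    if "e \<in> carrier (cohomology A n)" for e
    using zigzag_eq_cohomology[OF pq, of n] that by simp
  ultimately show ?thesis
    using assms(2,3) by metis
qed

section \<open>Nonzero morphisms and visibility triangles\<close>

lemma derived_hom_nonzero:
  assumes T: "triangulated_category K T" and "derived_hom K T RHom"
    and X: "X \<in> ob T" and Y: "Y \<in> ob T"
    and f: "f \<in> carrier (hm T X Y)" "f \<noteq> \<zero>\<^bsub>hm T X Y\<^esub>"
  shows "\<not> derived_isomorphic K (RHom X Y) zero_complex"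
proof
  assume zero: "derived_isomorphic K (RHom X Y) zero_complex"
  interpret T: triangulated_category K T by fact
  interpret H: module K "hm T X Y" using X Y by (rule T.hom_module)
  have "\<exists>\<phi>. linear_iso K (cohomology (RHom X Y) 0) (hm T X (shift_by T 0 Y)) \<phi>"
    using assms by (auto simp: derived_hom_def)
  \<comment> \<open>Degree zero falls under the first branch of \<open>shift_by\<close>, with no
    iteration of the shift, so the target is \<open>hm T X Y\<close> itself.\<close>
  then obtain \<phi> where "bij_betw \<phi> (carrier (cohomology (RHom X Y) 0)) (carrier (hm T X Y))"
    by (auto simp: linear_iso_def shift_by_def)
  then have im: "carrier (hm T X Y) = \<phi> ` carrier (cohomology (RHom X Y) 0)"
    by (simp add: bij_betw_def)
  \<comment> \<open>The distinct morphisms \<open>f\<close> and zero both lift along \<phi>, but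
    acyclicity forces the two lifts to be equal.\<close>
  obtain c where c: "c \<in> carrier (cohomology (RHom X Y) 0)" "f = \<phi> c"
    using f(1) im by blast
  obtain d where d: "d \<in> carrier (cohomology (RHom X Y) 0)" "\<zero>\<^bsub>hm T X Y\<^esub> = \<phi> d"
    using H.zero_closed im by blast
  have "f = \<zero>\<^bsub>hm T X Y\<^esub>"
    using derived_isomorphic_zero_cohomology[OF zero c(1) d(1)] c(2) d(2) by simp
  with f(2) show False by simp
qed

lemma right_triangle_visible_nonzero:
  assumes T: "triangulated_category K T" and R: "derived_hom K T RHom"
    and "right_triangle_visible T L X"
  shows "\<not> derived_isomorphic K (RHom X L) zero_complex"
proof -
  obtain B w u h where d: "dist T B X L w u h" and u: "u \<noteq> \<zero>\<^bsub>hm T X L\<^esub>"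
    using assms(3) by (auto simp: right_triangle_visible_def)
  show ?thesis
    using triangulated_category.dist_wf[OF T d] u by (intro derived_hom_nonzero[OF T R]) auto
qed

lemma left_triangle_visible_nonzero:
  assumes T: "triangulated_category K T" and R: "derived_hom K T RHom"
    and "left_triangle_visible T L X"
  shows "\<not> derived_isomorphic K (RHom L X) zero_complex"
proof -
  obtain C v g h where d: "dist T L X C v g h" and v: "v \<noteq> \<zero>\<^bsub>hm T L X\<^esub>"
    using assms(3) by (auto simp: left_triangle_visible_def)
  show ?thesis
    using triangulated_category.dist_wf[OF T d] v by (intro derived_hom_nonzero[OF T R]) auto
qed

theorem proposition1p5:
  fixes K :: "'k ring" and r :: nat
    and Cbulk :: "('k, 'p, 'n) tricat"
    and C :: "nat \<Rightarrow> ('k, 'o, 'm) tricat"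
    and \<Phi> :: "nat \<Rightarrow> ('o, 'm, 'p, 'n) fnc"
    and \<Psi> :: "nat \<Rightarrow> ('p, 'n, 'o, 'm) fnc"
    and L :: "nat \<Rightarrow> 'o"
    and RHom :: "nat \<Rightarrow> 'o \<Rightarrow> 'o \<Rightarrow> ('k, 'v) vcomplex"
    and j :: nat and X :: 'o
  assumes "mediated_triangle_transport_datum K r Cbulk C \<Phi> \<Psi> L"
    and "\<And>i. i \<in> {1..r} \<Longrightarrow> derived_hom K (C i) (RHom i)"
    and "j \<in> {1..r}"
    and "X \<in> ob (C j)"
  shows "(right_triangle_visible (C j) (L j) X \<longrightarrow>
            \<not> derived_isomorphic K (RHom j X (L j)) zero_complex) \<and>
         (left_triangle_visible (C j) (L j) X \<longrightarrow>
            \<not> derived_isomorphic K (RHom j (L j) X) zero_complex) \<and>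
         (\<forall>i\<in>{1..r}. right_triangle_visible (C j) (L j) (transported_probe \<Phi> \<Psi> L i j) \<longrightarrow>
            \<not> derived_isomorphic K (transport_hom \<Phi> \<Psi> L RHom i j) zero_complex)"
proof -
  have T: "triangulated_category K (C j)"
    using assms(1,3) by (rule mediated_triangle_transport_datum.local_triangulated)
  have R: "derived_hom K (C j) (RHom j)"
    using assms(2,3) .
  \<comment> \<open>The third claim is the first with the transported probe in place of
    \<open>X\<close>; its visibility triangle makes it an object of \<open>C j\<close>.\<close>
  show ?thesis
    unfolding transport_hom_def
    using right_triangle_visible_nonzero[OF T R] left_triangle_visible_nonzero[OF T R] by blast
qed

end
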